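(* Let $\varphi : [0,\infty) \to [-\infty,\infty]$ be a function, and define $\psi : [-\infty,\infty) \to [-\infty,\infty]$ by $\psi(x) := \varphi(e^x)$ for all $x \in [-\infty,\infty)$ (with $e^{-\infty} = 0$). Suppose that $\psi$ is convex and strictly increasing on its domain $[-\infty,\infty)$, and that $\psi(\mathbb{R}) \subseteq \mathbb{R}$. Then for each fixed real $\alpha > 0$, $\mathrm{FDPD}_{\varphi,\alpha}$ is a valid divergence on $\mathcal{L}_{\mu,\alpha}$.
   Context: Let $\mu$ be Lebesgue measure on $\mathbb{R}$ (with the Borel $\sigma$-algebra); all integrals and almost-everywhere statements are with respect to $\mu$. Let $\mathcal{L}_\mu$ be the set of measurable functions $f : \mathbb{R} \to \mathbb{R}$ with $f \ge 0$ and $\int_{\mathbb{R}} f \, d\mu = 1$. For $\alpha > 0$ let $\mathcal{L}_{\mu,\alpha} := \{ f \in \mathcal{L}_\mu : \int_{\mathbb{R}} f^{1+\alpha}\, d\mu < \infty \}$. For $\varphi : [0,\infty) \to [-\infty,\infty]$ and $\alpha > 0$, define for $g, f \in \mathcal{L}_{\mu,\alpha}$ $$\mathrm{FDPD}_{\varphi,\alpha}(g,f) := \varphi\Big(\int_{\mathbb{R}} f^{\alpha+1}\Big) - \Big(1 + \frac{1}{\alpha}\Big)\varphi\Big(\int_{\mathbb{R}} f^{\alpha} g\Big) + \frac{1}{\alpha}\,\varphi\Big(\int_{\mathbb{R}} g^{\alpha+1}\Big).$$ $\mathrm{FDPD}_{\varphi,\alpha}$ is called a valid divergence if this expression is well defined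 in the extended reals (no $\infty - \infty$ occurs) for all $g, f \in \mathcal{L}_{\mu,\alpha}$, takes values in $[0,\infty]$, and satisfies $\mathrm{FDPD}_{\varphi,\alpha}(g,f) = 0 \iff g = f$ a.e. $[\mu]$. Convexity of $\psi$ on $[-\infty,\infty)$ means $\psi(\lambda x + (1-\lambda) y) \le \lambda \psi(x) + (1-\lambda)\psi(y)$ for all $x,y \in [-\infty,\infty)$ and $\lambda \in (0,1)$, with the usual extended-real arithmetic. *)

theory Defs
  imports "HOL-Analysis.Analysis"
begin

text \<open>Only the values on \<open>[-\<infinity>, \<infinity>)\<close> are meaningful; the value at \<open>\<infinity>\<close> is a dummy.\<close>

definition exp_ereal :: "ereal \<Rightarrow> real" where
  "exp_ereal x = (if x = -\<infinity> then 0 else exp (real_of_ereal x))"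

text \<open>
  The library addition on \<^typ>\<open>ereal\<close> sets \<open>\<infinity> + -\<infinity> = \<infinity>\<close>. This convention never matters for
  functions that are below \<open>\<infinity>\<close> on \<open>[-\<infinity>, \<infinity>)\<close>, such as those which are real on the reals
  and strictly increasing.
\<close>

definition ereal_convex :: "(ereal \<Rightarrow> ereal) \<Rightarrow> bool" where
  "ereal_convex \<psi> \<longleftrightarrow>
     (\<forall>x\<in>{..<\<infinity>}. \<forall>y\<in>{..<\<infinity>}. \<forall>t::real. 0 < t \<and> t < 1 \<longrightarrow>
        \<psi> (ereal t * x + ereal (1 - t) * y) \<le> ereal t * \<psi> x + ereal (1 - t) * \<psi> y)"

definition densities :: "(real \<Rightarrow> real) set" where
  "densities = {f. f \<in> borel_measurable borel \<and> (\<forall>x. 0 \<le> f x) \<and>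
                   integrable lborel f \<and> (LINT x|lborel. f x) = 1}"

definition densities_pow :: "real \<Rightarrow> (real \<Rightarrow> real) set" where
  "densities_pow \<alpha> = {f \<in> densities. integrable lborel (\<lambda>x. f x powr (1 + \<alpha>))}"

text \<open>
  A function on \<open>[0, \<infinity>)\<close> is represented by a function on all reals; its values at negative
  arguments are never used, since the integrals below are nonnegative.
\<close>

definition FDPD ::
  "(real \<Rightarrow> ereal) \<Rightarrow> real \<Rightarrow> (real \<Rightarrow> real) \<Rightarrow> (real \<Rightarrow> real) \<Rightarrow> ereal" where
  "FDPD \<phi> \<alpha> g f =
     \<phi> (LINT x|lborel. f x powr (\<alpha> + 1))
     - ereal (1 + 1 / \<alpha>) * \<phi> (LINT x|lborel. f x powr \<alpha> * g x)
     + ereal (1 / \<alpha>) * \<phi> (LINT x|lborel. g x powr (\<alpha> + 1))"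

text \<open>
  Both Bochner integrals and extended real arithmetic are total in the library (a divergent
  integral is \<open>0\<close>, and \<open>\<infinity> - \<infinity> = \<infinity>\<close>), so well-definedness of the expression has to be
  stated separately: the arguments of \<open>\<phi>\<close> are finite, and the three summands do not
  include both \<open>\<infinity>\<close> and \<open>-\<infinity>\<close>.
\<close>

definition FDPD_well_defined ::
  "(real \<Rightarrow> ereal) \<Rightarrow> real \<Rightarrow> (real \<Rightarrow> real) \<Rightarrow> (real \<Rightarrow> real) \<Rightarrow> bool" where
  "FDPD_well_defined \<phi> \<alpha> g f \<longleftrightarrow>
     integrable lborel (\<lambda>x. f x powr (\<alpha> + 1)) \<and>
     integrable lborel (\<lambda>x. f x powr \<alpha> * g x) \<and>
     integrable lborel (\<lambda>x. g x powr (\<alpha> + 1)) \<and>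
     (let S = {\<phi> (LINT x|lborel. f x powr (\<alpha> + 1)),
               - (ereal (1 + 1 / \<alpha>) * \<phi> (LINT x|lborel. f x powr \<alpha> * g x)),
               ereal (1 / \<alpha>) * \<phi> (LINT x|lborel. g x powr (\<alpha> + 1))}
      in \<not> (\<infinity> \<in> S \<and> -\<infinity> \<in> S))"

definition FDPD_valid_divergence :: "(real \<Rightarrow> ereal) \<Rightarrow> real \<Rightarrow> bool" where
  "FDPD_valid_divergence \<phi> \<alpha> \<longleftrightarrow>
     (\<forall>g\<in>densities_pow \<alpha>. \<forall>f\<in>densities_pow \<alpha>.
        FDPD_well_defined \<phi> \<alpha> g f \<and>
        FDPD \<phi> \<alpha> g f \<in> {0..\<infinity>} \<and>
        (FDPD \<phi> \<alpha> g f = 0 \<longleftrightarrow> (AE x in lborel. g x = f x)))"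

end

theory Submission
  imports Defs
begin

text \<open>
  Write \<open>A = \<integral>f\<^sup>1\<^sup>+\<^sup>\<alpha>\<close>, \<open>B = \<integral>f\<^sup>\<alpha> g\<close>, \<open>C = \<integral>g\<^sup>1\<^sup>+\<^sup>\<alpha>\<close> and \<open>t = \<alpha> / (1 + \<alpha>)\<close>. The numbers
  \<open>A\<close> and \<open>C\<close> are positive, because \<open>f\<close> and \<open>g\<close> have integral 1. Hoelder's inequality gives
  \<open>B \<le> A\<^sup>t C\<^sup>1\<^sup>-\<^sup>t\<close>. Convexity of \<open>\<psi>\<close> means that \<open>\<phi>\<close> is convex along geometric means, so, since
  \<open>\<phi>\<close> is increasing,
  \<open>\<phi> B \<le> \<phi> (A\<^sup>t C\<^sup>1\<^sup>-\<^sup>t) \<le> t \<phi> A + (1 - t) \<phi> C\<close>.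
  Division by \<open>t\<close> turns this into nonnegativity of the divergence, as \<open>1 / t = 1 + 1 / \<alpha>\<close> and
  \<open>(1 - t) / t = 1 / \<alpha>\<close>. Because \<open>\<phi>\<close> is real at \<open>A\<close> and \<open>C\<close> and below \<open>\<infinity>\<close> at \<open>B\<close>, the only
  possible infinity is \<open>\<phi> 0 = -\<infinity>\<close> for \<open>B = 0\<close>, and it makes the divergence \<open>\<infinity>\<close>.

  If the divergence vanishes, both inequalities are equalities; strict monotonicity then forces
  equality in Hoelder's inequality, which makes \<open>f\<^sup>1\<^sup>+\<^sup>\<alpha>\<close> and \<open>g\<^sup>1\<^sup>+\<^sup>\<alpha>\<close> proportional almost
  everywhere. Hence \<open>f\<close> and \<open>g\<close> are proportional, and they agree since both have integral 1.
  Conversely, if \<open>f = g\<close> almost everywhere then \<open>A = B = C\<close> and the three summands cancel.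

  The two inequalities are \<open>cross_integral\<close>, derived from \<open>Hoelder_weighted\<close>, and
  \<open>phi_geometrically_convex\<close>; \<open>divergence_value\<close> combines them.
\<close>

section \<open>Hoelder's inequality and its equality case\<close>

text \<open>
  For positive \<open>a\<close> and \<open>b\<close> and \<open>m = t * a + (1 - t) * b\<close>, add the bounds \<open>ln x \<le> x - 1\<close> at
  \<open>x = a / m\<close> and \<open>x = b / m\<close> with weights \<open>t\<close> and \<open>1 - t\<close>. The right-hand sides cancel, and the bound is sharp only at
  \<open>x = 1\<close>, which settles the equality case as well.
\<close>

lemma weighted_geometric_le_arithmetic_mean:
  fixes a b t :: real
  assumes "a \<ge> 0" "b \<ge> 0" "0 < t" "t < 1"
  shows "a powr t * b powr (1 - t) \<le> t * a + (1 - t) * b"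
    and "a powr t * b powr (1 - t) = t * a + (1 - t) * b \<Longrightarrow> a = b"
proof -
  define m where "m = t * a + (1 - t) * b"
  have main: "a powr t * b powr (1 - t) \<le> m \<and> (a powr t * b powr (1 - t) = m \<longrightarrow> a = b)"
  proof (cases "a = 0 \<or> b = 0")
    case True
    then show ?thesis
      using assms by (auto simp: m_def)
  next
    case False
    then have ab: "a > 0" "b > 0"
      using assms by auto
    then have m: "m > 0"
      using assms by (auto simp: m_def intro!: add_pos_pos)
    define p where "p = a powr t * b powr (1 - t)"
    have p: "p > 0" using ab by (simp add: p_def)
    have ln_p: "ln p - ln m = t * ln (a / m) + (1 - t) * ln (b / m)"
      using ab m by (simp add: p_def ln_mult ln_div ln_powr algebra_simps)
    have cancel: "t * (a / m - 1) + (1 - t) * (b / m - 1) = 0"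
      using m by (simp add: field_simps) (simp add: m_def algebra_simps)
    have bounds: "ln (a / m) \<le> a / m - 1" "ln (b / m) \<le> b / m - 1"
      using ab m by (auto intro!: ln_le_minus_one)
    have weighted: "t * ln (a / m) \<le> t * (a / m - 1)"
        "(1 - t) * ln (b / m) \<le> (1 - t) * (b / m - 1)"
      using bounds assms by (auto intro!: mult_left_mono)
    have le: "p \<le> m"
      using ln_p cancel weighted p m by (simp flip: ln_le_cancel_iff)
    have "a = b" if "p = m"
    proof -
      have "t * ln (a / m) + (1 - t) * ln (b / m) = 0"
        using that ln_p by simp
      then have "t * ln (a / m) = t * (a / m - 1)" "(1 - t) * ln (b / m) = (1 - t) * (b / m - 1)"
        using cancel weighted by linarith+
      then have "ln (a / m) = a / m - 1" "ln (b / m) = b / m - 1"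
        using assms by simp_all
      then have "a / m = 1" "b / m = 1"
        using ab m by (blast intro: ln_eq_minus_one divide_pos_pos)+
      then show ?thesis using m by simp
    qed
    with le show ?thesis by (simp add: p_def)
  qed
  show "a powr t * b powr (1 - t) \<le> t * a + (1 - t) * b"
    using main by (simp add: m_def)
  show "a = b" if "a powr t * b powr (1 - t) = t * a + (1 - t) * b"
    using main that by (simp add: m_def)
qed

lemma integrable_weighted_geometric_mean:
  fixes u v :: "'a \<Rightarrow> real"
  assumes "integrable M u" "integrable M v"
    and "\<And>x. u x \<ge> 0" "\<And>x. v x \<ge> 0" and "0 < t" "t < 1"
  shows "integrable M (\<lambda>x. u x powr t * v x powr (1 - t))"
proof (rule Bochner_Integration.integrable_bound)
  show "integrable M (\<lambda>x. t * u x + (1 - t) * v x)"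
    using assms by simp
  show "(\<lambda>x. u x powr t * v x powr (1 - t)) \<in> borel_measurable M"
    using assms(1,2)[THEN borel_measurable_integrable] by measurable
  show "AE x in M. norm (u x powr t * v x powr (1 - t)) \<le> norm (t * u x + (1 - t) * v x)"
    using assms weighted_geometric_le_arithmetic_mean(1)[of "u _" "v _" t] by (auto simp: abs_mult)
qed

text \<open>
  After normalising \<open>u\<close> and \<open>v\<close> to integral 1, the pointwise mean inequality has right-hand side
  of integral \<open>t + (1 - t) = 1\<close>. The difference of the two sides is nonnegative, so equality of the
  integrals forces the pointwise equality case almost everywhere.
\<close>

lemma Hoelder_weighted:
  fixes u v :: "'a \<Rightarrow> real"
  assumes u: "integrable M u" "\<And>x. u x \<ge> 0" "(LINT x|M. u x) > 0"
    and v: "integrable M v" "\<And>x. v x \<ge> 0" "(LINT x|M. v x) > 0"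
    and t: "0 < t" "t < 1"
  defines "H \<equiv> (LINT x|M. u x) powr t * (LINT x|M. v x) powr (1 - t)"
  shows "(LINT x|M. u x powr t * v x powr (1 - t)) \<le> H"
    and "(LINT x|M. u x powr t * v x powr (1 - t)) = H \<Longrightarrow>
           AE x in M. u x / (LINT x|M. u x) = v x / (LINT x|M. v x)"
proof -
  define U V where "U = (LINT x|M. u x)" and "V = (LINT x|M. v x)"
  have UV: "U > 0" "V > 0" using u v by (simp_all add: U_def V_def)
  have H: "H = U powr t * V powr (1 - t)" "H > 0" using UV by (simp_all add: H_def U_def V_def)
  define d where "d x = t * (u x / U) + (1 - t) * (v x / V) - u x powr t * v x powr (1 - t) / H" for x
  have normalise: "u x powr t * v x powr (1 - t) / H = (u x / U) powr t * (v x / V) powr (1 - t)" for x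
    using UV u(2)[of x] v(2)[of x] by (simp add: H powr_divide)
  have d_nonneg: "d x \<ge> 0" for x
    using weighted_geometric_le_arithmetic_mean(1)[of "u x / U" "v x / V" t] t UV u(2)[of x] v(2)[of x]
    unfolding d_def normalise by simp
  note int = integrable_weighted_geometric_mean[OF u(1) v(1) u(2) v(2) t]
  have d_int: "integrable M d"
    unfolding d_def using u(1) v(1) int by simp
  have integral_d: "(LINT x|M. d x) = 1 - (LINT x|M. u x powr t * v x powr (1 - t)) / H"
    unfolding d_def using u(1) v(1) int UV by (simp flip: U_def V_def)
  have "(LINT x|M. d x) \<ge> 0"
    using d_nonneg by simp
  then show "(LINT x|M. u x powr t * v x powr (1 - t)) \<le> H"
    using integral_d H(2) by (simp add: field_simps)
  show "AE x in M. u x / (LINT x|M. u x) = v x / (LINT x|M. v x)"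
    if "(LINT x|M. u x powr t * v x powr (1 - t)) = H"
  proof -
    have "(LINT x|M. d x) = 0"
      using integral_d that H(2) by simp
    then have "AE x in M. d x = 0"
      using integral_nonneg_eq_0_iff_AE[OF d_int] d_nonneg by simp
    then show ?thesis
    proof (rule AE_mp, intro AE_I2 impI)
      fix x assume "d x = 0"
      then have "(u x / U) powr t * (v x / V) powr (1 - t) = t * (u x / U) + (1 - t) * (v x / V)"
        unfolding d_def normalise by simp
      then have "u x / U = v x / V"
        using weighted_geometric_le_arithmetic_mean(2)[of "u x / U" "v x / V" t]
          t UV u(2)[of x] v(2)[of x] by simp
      then show "u x / (LINT x|M. u x) = v x / (LINT x|M. v x)"
        by (simp add: U_def V_def)
    qed
  qed
qed

section \<open>Density power integrals\<close>

lemma densities_powD: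
  assumes "f \<in> densities_pow \<alpha>"
  shows "f \<in> borel_measurable borel" "f x \<ge> 0" "integrable lborel f" "(LINT x|lborel. f x) = 1"
    and "integrable lborel (\<lambda>x. f x powr (\<alpha> + 1))"
  using assms by (auto simp: densities_pow_def densities_def add.commute)

lemma density_power_integral_pos:
  assumes "f \<in> densities_pow \<alpha>"
  shows "(LINT x|lborel. f x powr (\<alpha> + 1)) > 0"
proof (rule ccontr)
  note f = densities_powD[OF assms]
  have "(LINT x|lborel. f x powr (\<alpha> + 1)) \<ge> 0"
    by simp
  moreover assume "\<not> ?thesis"
  ultimately have "(LINT x|lborel. f x powr (\<alpha> + 1)) = 0"
    by linarith
  then have "AE x in lborel. f x = 0"
    using integral_nonneg_eq_0_iff_AE[OF f(5)] by simp
  then have "(LINT x|lborel. f x) = 0"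
    by (rule integral_eq_zero_AE)
  then show False using f(4) by simp
qed

text \<open>
  Hoelder's inequality is used with \<open>u = f\<^sup>1\<^sup>+\<^sup>\<alpha>\<close> and \<open>v = g\<^sup>1\<^sup>+\<^sup>\<alpha>\<close>, whose weighted geometric mean
  is the cross term.
\<close>

lemma cross_term_eq_geometric_mean:
  fixes a b \<alpha> :: real
  assumes "b \<ge> 0" "\<alpha> > 0"
  shows "(a powr (\<alpha> + 1)) powr (\<alpha> / (1 + \<alpha>)) * (b powr (\<alpha> + 1)) powr (1 - \<alpha> / (1 + \<alpha>))
           = a powr \<alpha> * b"
proof -
  have "(\<alpha> + 1) * (\<alpha> / (1 + \<alpha>)) = \<alpha>" "(\<alpha> + 1) * (1 - \<alpha> / (1 + \<alpha>)) = 1"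
    using assms by (simp_all add: field_simps)
  then show ?thesis using assms by (simp only: powr_powr) simp
qed

text \<open>
  In the equality case \<open>f\<^sup>1\<^sup>+\<^sup>\<alpha> / A = g\<^sup>1\<^sup>+\<^sup>\<alpha> / C\<close> almost everywhere, for the integrals \<open>A\<close> and \<open>C\<close> of
  the two powers. Taking roots shows that \<open>g\<close> is a constant multiple of \<open>f\<close>.
\<close>

lemma cross_integral:
  assumes f: "f \<in> densities_pow \<alpha>" and g: "g \<in> densities_pow \<alpha>" and alpha: "\<alpha> > 0"
  defines "t \<equiv> \<alpha> / (1 + \<alpha>)"
  defines "H \<equiv> (LINT x|lborel. f x powr (\<alpha> + 1)) powr t * (LINT x|lborel. g x powr (\<alpha> + 1)) powr (1 - t)"
  shows "integrable lborel (\<lambda>x. f x powr \<alpha> * g x)"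
    and "(LINT x|lborel. f x powr \<alpha> * g x) \<le> H"
    and "(LINT x|lborel. f x powr \<alpha> * g x) = H \<Longrightarrow> AE x in lborel. g x = f x"
proof -
  note F = densities_powD[OF f] and G = densities_powD[OF g]
  have t: "0 < t" "t < 1" using alpha by (simp_all add: t_def)
  define A C where "A = (LINT x|lborel. f x powr (\<alpha> + 1))" and "C = (LINT x|lborel. g x powr (\<alpha> + 1))"
  have AC: "A > 0" "C > 0"
    using density_power_integral_pos f g by (simp_all add: A_def C_def)
  have cross: "(f x powr (\<alpha> + 1)) powr t * (g x powr (\<alpha> + 1)) powr (1 - t) = f x powr \<alpha> * g x" for x
    using cross_term_eq_geometric_mean[of "g x" \<alpha> "f x"] G(2) alpha by (simp add: t_def)
  show "integrable lborel (\<lambda>x. f x powr \<alpha> * g x)"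
    using integrable_weighted_geometric_mean[OF F(5) G(5) _ _ t] by (simp add: cross)
  note hoelder = Hoelder_weighted[OF F(5) _ _ G(5) _ _ t, unfolded cross,
      folded A_def C_def, OF _ AC(1) _ AC(2)]
  have H: "H = A powr t * C powr (1 - t)"
    by (simp add: H_def A_def C_def)
  show "(LINT x|lborel. f x powr \<alpha> * g x) \<le> H"
    using hoelder(1) by (simp add: H)
  assume "(LINT x|lborel. f x powr \<alpha> * g x) = H"
  then have proportional: "AE x in lborel. f x powr (\<alpha> + 1) / A = g x powr (\<alpha> + 1) / C"
    using hoelder(2) by (simp add: H)
  define c where "c = (C / A) powr (1 / (\<alpha> + 1))"
  have g_eq: "AE x in lborel. g x = c * f x"
    using proportional
  proof (rule AE_mp, intro AE_I2 impI)
    fix x assume "f x powr (\<alpha> + 1) / A = g x powr (\<alpha> + 1) / C"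
    then have "g x powr (\<alpha> + 1) = C / A * f x powr (\<alpha> + 1)"
      using AC by (simp add: field_simps)
    then have "(g x powr (\<alpha> + 1)) powr (1 / (\<alpha> + 1))
        = (C / A * f x powr (\<alpha> + 1)) powr (1 / (\<alpha> + 1))"
      by simp
    also have "\<dots> = c * (f x powr (\<alpha> + 1)) powr (1 / (\<alpha> + 1))"
      unfolding c_def by (rule powr_mult)
    finally show "g x = c * f x"
      using F(2)[of x] G(2)[of x] alpha by (simp add: powr_powr)
  qed
  \<comment> \<open>Both densities have integral 1, so the proportionality constant is 1.\<close>
  have "(LINT x|lborel. g x) = (LINT x|lborel. c * f x)"
    using g_eq F(1) G(1) by (intro integral_cong_AE) auto
  then have "c = 1"
    using F(4) G(4) by simp
  with g_eq show "AE x in lborel. g x = f x" by simp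
qed

section \<open>Properties of \<open>\<phi>\<close>\<close>

text \<open>
  On positive arguments the substitution \<open>x = exp r\<close> transports the properties of \<open>\<psi>\<close>; addition of
  logarithms turns arithmetic means into geometric means.
\<close>

context
  fixes \<phi> :: "real \<Rightarrow> ereal" and \<psi> :: "ereal \<Rightarrow> ereal"
  assumes psi: "\<And>x. x < \<infinity> \<Longrightarrow> \<psi> x = \<phi> (exp_ereal x)"
begin

lemma phi_eq_psi:
  "x > 0 \<Longrightarrow> \<phi> x = \<psi> (ereal (ln x))" "\<phi> 0 = \<psi> (-\<infinity>)"
  by (simp_all add: psi exp_ereal_def)

lemma phi_strict_mono:
  assumes "strict_mono_on {..<\<infinity>} \<psi>" "0 \<le> x" "x < y"
  shows "\<phi> x < \<phi> y"
proof (cases "x = 0")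
  case True
  then show ?thesis
    using assms strict_mono_onD[OF assms(1), of "-\<infinity>" "ereal (ln y)"] by (simp add: phi_eq_psi)
next
  case False
  then show ?thesis
    using assms strict_mono_onD[OF assms(1), of "ereal (ln x)" "ereal (ln y)"]
    by (simp add: phi_eq_psi)
qed

lemma phi_real:
  assumes "\<psi> ` range ereal \<subseteq> range ereal" "x > 0"
  obtains r where "\<phi> x = ereal r"
proof -
  have "\<psi> (ereal (ln x)) \<in> range ereal" using assms(1) by blast
  then show ?thesis using that assms(2) by (auto simp only: phi_eq_psi)
qed

lemma phi_geometrically_convex:
  assumes "ereal_convex \<psi>" "x > 0" "y > 0" "0 < t" "t < 1"
  shows "\<phi> (x powr t * y powr (1 - t)) \<le> ereal t * \<phi> x + ereal (1 - t) * \<phi> y"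
proof -
  have "\<psi> (ereal t * ereal (ln x) + ereal (1 - t) * ereal (ln y))
      \<le> ereal t * \<psi> (ereal (ln x)) + ereal (1 - t) * \<psi> (ereal (ln y))"
    using assms by (auto simp: ereal_convex_def simp del: times_ereal.simps plus_ereal.simps)
  then show ?thesis
    using assms by (simp add: phi_eq_psi ln_mult ln_powr)
qed

end

section \<open>The divergence\<close>

text \<open>
  If \<open>m\<close> is the weighted mean of \<open>p = \<phi> A\<close> and \<open>q = \<phi> C\<close> that bounds \<open>b = \<phi> B\<close>, then
  \<open>p + q / \<alpha> = (1 + 1 / \<alpha>) * m\<close>, so the divergence is the gap \<open>m - b\<close> scaled by \<open>1 + 1 / \<alpha>\<close>. For
  \<open>b = -\<infinity>\<close> the gap is \<open>\<infinity>\<close>.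
\<close>

lemma divergence_value:
  fixes p q \<alpha> :: real and b :: ereal
  assumes alpha: "\<alpha> > 0"
    and b: "b \<le> ereal (\<alpha> / (1 + \<alpha>) * p + (1 - \<alpha> / (1 + \<alpha>)) * q)"
  defines "D \<equiv> ereal p - ereal (1 + 1 / \<alpha>) * b + ereal (1 / \<alpha>) * ereal q"
  shows "D \<in> {0..\<infinity>}"
    and "D = 0 \<longleftrightarrow> b = ereal (\<alpha> / (1 + \<alpha>) * p + (1 - \<alpha> / (1 + \<alpha>)) * q)"
proof -
  define m where "m = \<alpha> / (1 + \<alpha>) * p + (1 - \<alpha> / (1 + \<alpha>)) * q"
  have m: "p + q / \<alpha> = (1 + 1 / \<alpha>) * m"
    using alpha by (simp add: m_def divide_simps) (simp add: algebra_simps)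
  have pos: "1 + 1 / \<alpha> > 0" using alpha by (simp add: add_pos_pos)
  have "D \<in> {0..\<infinity>} \<and> (D = 0 \<longleftrightarrow> b = ereal m)"
  proof (cases b)
    case (real r)
    have "D = ereal ((1 + 1 / \<alpha>) * (m - r))"
      using m by (simp add: D_def real right_diff_distrib)
    then show ?thesis
      using b[folded m_def] pos by (auto simp: real)
  next
    case PInf
    then show ?thesis using b by simp
  next
    case MInf
    then show ?thesis using pos by (simp add: D_def)
  qed
  then show "D \<in> {0..\<infinity>}" "D = 0 \<longleftrightarrow> b = ereal (\<alpha> / (1 + \<alpha>) * p + (1 - \<alpha> / (1 + \<alpha>)) * q)"
    by (simp_all add: m_def)
qed

theorem proposition1:
  fixes \<phi> :: "real \<Rightarrow> ereal" and \<psi> :: "ereal \<Rightarrow> ereal" and \<alpha> :: real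
  assumes psi: "\<And>x. x < \<infinity> \<Longrightarrow> \<psi> x = \<phi> (exp_ereal x)"
    and convex: "ereal_convex \<psi>"
    and increasing: "strict_mono_on {..<\<infinity>} \<psi>"
    and real_valued: "\<psi> ` range ereal \<subseteq> range ereal"
    and alpha: "\<alpha> > 0"
  shows "FDPD_valid_divergence \<phi> \<alpha>"
  unfolding FDPD_valid_divergence_def
proof (intro ballI)
  fix g f assume g: "g \<in> densities_pow \<alpha>" and f: "f \<in> densities_pow \<alpha>"
  note F = densities_powD[OF f] and G = densities_powD[OF g]
  define t where "t = \<alpha> / (1 + \<alpha>)"
  have t: "0 < t" "t < 1" using alpha by (simp_all add: t_def)
  define A B C where "A = (LINT x|lborel. f x powr (\<alpha> + 1))"
    and "B = (LINT x|lborel. f x powr \<alpha> * g x)"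
    and "C = (LINT x|lborel. g x powr (\<alpha> + 1))"
  define H where "H = A powr t * C powr (1 - t)"
  have AC: "A > 0" "C > 0"
    using density_power_integral_pos f g by (simp_all add: A_def C_def)
  have B: "B \<ge> 0" "B \<le> H" and equality: "B = H \<Longrightarrow> AE x in lborel. g x = f x"
    using cross_integral(2,3)[OF f g alpha] G(2)
    by (auto simp: A_def B_def C_def H_def t_def)
  obtain p where p: "\<phi> A = ereal p" using phi_real[OF psi real_valued AC(1)] .
  obtain q where q: "\<phi> C = ereal q" using phi_real[OF psi real_valued AC(2)] .
  have phi_B: "\<phi> B \<le> \<phi> H" "B < H \<Longrightarrow> \<phi> B < \<phi> H"
    using B phi_strict_mono[OF psi increasing, of B H] by (auto simp: le_less)
  have phi_H: "\<phi> H \<le> ereal (t * p + (1 - t) * q)"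
    using phi_geometrically_convex[OF psi convex AC t] by (simp add: H_def p q)
  have phi_B_le: "\<phi> B \<le> ereal (t * p + (1 - t) * q)"
    using phi_B(1) phi_H by (rule order_trans)
  have FDPD: "FDPD \<phi> \<alpha> g f = ereal p - ereal (1 + 1 / \<alpha>) * \<phi> B + ereal (1 / \<alpha>) * ereal q"
    by (simp add: FDPD_def p q flip: A_def B_def C_def)
  note D = divergence_value[OF alpha phi_B_le[unfolded t_def], folded FDPD t_def]
  have "FDPD_well_defined \<phi> \<alpha> g f"
    using F(5) G(5) cross_integral(1)[OF f g alpha] phi_B_le alpha
    by (cases "\<phi> B") (auto simp: FDPD_well_defined_def Let_def p q simp flip: A_def B_def C_def)
  moreover have "FDPD \<phi> \<alpha> g f = 0 \<longleftrightarrow> (AE x in lborel. g x = f x)"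
  proof
    assume "FDPD \<phi> \<alpha> g f = 0"
    then have "\<phi> B = ereal (t * p + (1 - t) * q)" using D(2) by simp
    then have "B = H" using phi_B(2) phi_H B(2) by force
    then show "AE x in lborel. g x = f x" by (rule equality)
  next
    assume eq: "AE x in lborel. g x = f x"
    have "B = A"
      unfolding A_def B_def using eq F(1,2) G(1)
      by (intro integral_cong_AE) (auto simp: powr_add)
    moreover have "C = A"
      unfolding A_def C_def using eq F(1) G(1) by (intro integral_cong_AE) auto
    ultimately show "FDPD \<phi> \<alpha> g f = 0"
      using D(2) p q by (simp add: algebra_simps)
  qed
  ultimately show "FDPD_well_defined \<phi> \<alpha> g f \<and> FDPD \<phi> \<alpha> g f \<in> {0..\<infinity>} \<and>
      (FDPD \<phi> \<alpha> g f = 0 \<longleftrightarrow> (AE x in lborel. g x = f x))"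
    using D(1) by simp
qed

end
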